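(* Let $U, Y, V_U, J, S, \widehat{J}, \psi$ and, for each $h>0$, $U_h, Y_h, S_h, \widehat{J}_h, \widehat{j}_h, \psi_h, \Pi_h$ be as described in the context. Let $\tau>0$. Suppose the following. (1) $\widehat{U}$ is a real reflexive Banach space, $\widehat{U}\subset U$, and the map $\iota_{\widehat{U},U}\colon\widehat{U}\to U$, $w\mapsto w$, is continuous with dense image in $U$. There is a nondecreasing function $\rho_{\Pi}\colon[0,\infty)\to[0,\infty)$ with $\rho_\Pi(0)=0$ and $\|\Pi_h v-v\|_U\le\rho_\Pi(h)\|v\|_{\widehat{U}}$ for all $v\in\widehat{U}$ and $h>0$. (2) $W_U\subset V_U$ is a bounded set with $\mathrm{dom}(\psi)\subset W_U$ and $\mathrm{dom}(\psi_h)\subset W_U$ for all $h>0$. The gradient $\nabla\widehat{J}$ is Lipschitz continuous on $W_U$ with Lipschitz constant $L_{\nabla\widehat{J}}>0$. There is $\ell_{\nabla\widehat{J}}>0$ such that for all $h>0$ and $v_h\in W_U\cap U_h$, $\nabla\widehat{J}(v_h)\in\widehat{U}$ and $\|\nabla\widehat{J}(v_h)\|_{\widehat{U}}\le\ell_{\nabla\widehat{J}}$. There is a nondecreasing function $\rho_{\nabla\widehat{J}}\colon[0,\infty)\to[0,\infty)$ with $\rho_{\nabla\widehat{J}}(0)=0$ and $\|\nabla\widehat{J}_h(v_h)-\nabla\widehat{J}(v_h)\|_U\le\rho_{\nabla\widehat{J}}(h)$ for all $v_h\in W_U\cap U_h$ and $h>0$. (3) There is a nondecreasing function $\rho_{\mathrm{prox}}\colon[0,\infty)\to[0,\infty)$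 with $\rho_{\mathrm{prox}}(0)=0$ and $\|\mathrm{prox}_{\psi/\tau}(v_h)-\mathrm{prox}_{\psi_h/\tau}(v_h)\|_U\le\rho_{\mathrm{prox}}(h)$ for all $v_h\in U_h$ and $h>0$. Then for all $h>0$ and all $\bar v_h\in W_U\cap U_h$, $$\chi_{\mathrm{nor}}(\bar v_h;\tau)\le\chi_{\mathrm{nor},h}(\bar v_h;\tau)+(\tau+L_{\nabla\widehat{J}})\,\rho_{\mathrm{prox}}(h)+\rho_{\nabla\widehat{J}}(h)+\rho_\Pi(h)\,\ell_{\nabla\widehat{J}}.$$
   Context: Setting. $U$ is a real separable Hilbert space and $Y$ a real separable Banach space. $\psi\colon U\to(-\infty,\infty]$ is proper, closed (lower semicontinuous) and convex, with $\mathrm{dom}(\psi)=\{u\in U:\psi(u)<\infty\}$. $V_U\subset U$ is open with $\mathrm{dom}(\psi)\subset V_U$. $J\colon Y\times U\to\mathbb{R}$ and $S\colon V_U\to Y$ are continuously differentiable. Define $\widehat{J}\colon V_U\to\mathbb{R}$, $\widehat{J}(u)=J(S(u),u)$. Discretization. For each $h>0$, $U_h$ is a closed linear subspace of $U$ (with the inner product of $U$), $Y_h$ is a linear subspace of $Y$ (with the norm of $Y$), $\psi_h\colon U_h\to(-\infty,\infty]$ is proper, closed and convex with $\mathrm{dom}(\psi_h)\subset V_U$, and $S_h\colon V_U\to Y_h$ is continuously differentiable. Define $\widehat{J}_h\colon V_U\to\mathbb{R}$, $\widehat{J}_h(u)=J(S_h(u),u)$, and $\widehat{j}_h\colon U_h\cap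 V_U\to\mathbb{R}$, $\widehat{j}_h(u_h)=\widehat{J}_h(u_h)$. Gradients $\nabla\widehat{J},\nabla\widehat{J}_h$ are Riesz representatives of the derivatives in $U$; $\nabla\widehat{j}_h$ is the Riesz representative in $U_h$. $\Pi_h\colon U\to U_h$ is the orthogonal projection onto $U_h$; one has $\nabla\widehat{j}_h(u_h)=\Pi_h\nabla\widehat{J}_h(u_h)$. Proximity operator. For a real Hilbert space $H$ and proper, closed, convex $\phi\colon H\to(-\infty,\infty]$, $\mathrm{prox}_\phi(u)=\mathrm{argmin}_{v\in H}\,\tfrac12\|v-u\|_H^2+\phi(v)$. Here $\mathrm{prox}_{\psi/\tau}$ is taken in $H=U$ and $\mathrm{prox}_{\psi_h/\tau}$ in $H=U_h$. Criticality measures. $\chi_{\mathrm{nor}}(v;\tau)=\|\tau(v-\mathrm{prox}_{\psi/\tau}(v))+\nabla\widehat{J}(\mathrm{prox}_{\psi/\tau}(v))\|_U$ and $\chi_{\mathrm{nor},h}(v_h;\tau)=\|\tau(v_h-\mathrm{prox}_{\psi_h/\tau}(v_h))+\nabla\widehat{j}_h(\mathrm{prox}_{\psi_h/\tau}(v_h))\|_U$ for $v_h\in U_h$. *)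

theory Defs
  imports "HOL-Analysis.Analysis"
begin

text \<open>
  Functions on a closed linear subspace \<open>H\<close> of the ambient Hilbert space are represented by total
  functions on the ambient type, of which only the values on \<open>H\<close> are used; \<open>H = UNIV\<close> is the
  ambient space itself. Separability is the class \<^class>\<open>second_countable_topology\<close>.
\<close>

subsection \<open>Continuous differentiability\<close>

text \<open>
  \<open>F\<close> is continuously Frechet differentiable as a map from the open set \<open>V\<close> into the normed space
  \<open>Z\<close>, a linear subspace of the ambient type. Since \<open>Z\<close> need not be closed, the derivatives
  have to be required to take values in \<open>Z\<close>.
\<close>

definition cont_diff ::
    "'a::real_normed_vector set \<Rightarrow> 'b::real_normed_vector set \<Rightarrow> ('a \<Rightarrow> 'b) \<Rightarrow> bool" where
  "cont_diff V Z F \<longleftrightarrow>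
     (\<forall>u\<in>V. F u \<in> Z) \<and>
     (\<exists>F' :: 'a \<Rightarrow> 'a \<Rightarrow>\<^sub>L 'b.
        (\<forall>u\<in>V. (F has_derivative blinfun_apply (F' u)) (at u)) \<and>
        (\<forall>u\<in>V. range (blinfun_apply (F' u)) \<subseteq> Z) \<and>
        continuous_on V F')"

subsection \<open>Reduced objective and gradients\<close>

definition reduced_obj :: "('y \<times> 'u \<Rightarrow> real) \<Rightarrow> ('u \<Rightarrow> 'y) \<Rightarrow> 'u \<Rightarrow> real" where
  "reduced_obj J S u = J (S u, u)"

text \<open>
  Riesz representative in \<open>H\<close> of the derivative at \<open>u \<in> H\<close> of \<open>f\<close> restricted to \<open>H\<close>.
  For \<open>H = UNIV\<close> this is the \<open>g\<close> with \<open>GDERIV f u :> g\<close>.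
\<close>

definition gradient :: "'a::real_inner set \<Rightarrow> ('a \<Rightarrow> real) \<Rightarrow> 'a \<Rightarrow> 'a" where
  "gradient H f u =
     (THE g. g \<in> H \<and> (f has_derivative (\<lambda>d. inner d g)) (at u within H))"

definition orth_proj :: "'a::real_inner set \<Rightarrow> 'a \<Rightarrow> 'a" where
  "orth_proj H u = (THE p. p \<in> H \<and> (\<forall>w\<in>H. orthogonal (u - p) w))"

subsection \<open>Extended-valued convex functions and proximity operators\<close>

definition dom_in :: "'a set \<Rightarrow> ('a \<Rightarrow> ereal) \<Rightarrow> 'a set" where
  "dom_in H \<phi> = {u \<in> H. \<phi> u < \<infinity>}"

definition proper_in :: "'a set \<Rightarrow> ('a \<Rightarrow> ereal) \<Rightarrow> bool" where
  "proper_in H \<phi> \<longleftrightarrow> (\<forall>u\<in>H. \<phi> u \<noteq> - \<infinity>) \<and> dom_in H \<phi> \<noteq> {}"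

definition lsc_in :: "'a::topological_space set \<Rightarrow> ('a \<Rightarrow> ereal) \<Rightarrow> bool" where
  "lsc_in H \<phi> \<longleftrightarrow> (\<forall>u\<in>H. \<phi> u \<le> Liminf (at u within H) \<phi>)"

text \<open>At \<open>t \<in> {0, 1}\<close> the convention \<open>0 * \<infinity> = 0\<close> of \<^typ>\<open>ereal\<close> makes the inequality trivial.\<close>

definition convex_in :: "'a::real_vector set \<Rightarrow> ('a \<Rightarrow> ereal) \<Rightarrow> bool" where
  "convex_in H \<phi> \<longleftrightarrow>
     (\<forall>u\<in>H. \<forall>v\<in>H. \<forall>t\<in>{0..1}.
        \<phi> ((1 - t) *\<^sub>R u + t *\<^sub>R v) \<le> ereal (1 - t) * \<phi> u + ereal t * \<phi> v)"

definition prox :: "'a::real_inner set \<Rightarrow> ('a \<Rightarrow> ereal) \<Rightarrow> 'a \<Rightarrow> 'a" where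
  "prox H \<phi> u = arg_min (\<lambda>v. ereal (1/2 * (norm (v - u))\<^sup>2) + \<phi> v) (\<lambda>v. v \<in> H)"

subsection \<open>Criticality measure of the normal map\<close>

text \<open>
  The continuous measure is the instance \<open>H = UNIV\<close>, the discrete one the instance where \<open>H\<close> is
  the discretization space; both the proximity operator and the gradient are then taken in \<open>H\<close>.
\<close>

definition chi_nor ::
    "'a::real_inner set \<Rightarrow> ('a \<Rightarrow> ereal) \<Rightarrow> ('a \<Rightarrow> real) \<Rightarrow> real \<Rightarrow> 'a \<Rightarrow> real" where
  "chi_nor H \<phi> f \<tau> v =
     (let p = prox H (\<lambda>u. \<phi> u / ereal \<tau>) v
      in norm (\<tau> *\<^sub>R (v - p) + gradient H f p))"

subsection \<open>Reflexivity and error functions\<close>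

text \<open>The canonical embedding into the bidual is onto.\<close>

definition reflexive_space :: "'a::real_normed_vector itself \<Rightarrow> bool" where
  "reflexive_space _ \<longleftrightarrow>
     (\<forall>\<Phi> :: ('a \<Rightarrow>\<^sub>L real) \<Rightarrow>\<^sub>L real. \<exists>x :: 'a. \<forall>f. blinfun_apply \<Phi> f = blinfun_apply f x)"

definition error_fun :: "(real \<Rightarrow> real) \<Rightarrow> bool" where
  "error_fun \<rho> \<longleftrightarrow> \<rho> \<in> {0..} \<rightarrow> {0..} \<and> mono_on {0..} \<rho> \<and> \<rho> 0 = 0"

end

theory Submission
  imports Defs
begin

text \<open>
  With \<open>p\<close> and \<open>p\<^sub>h\<close> the two proximal points of \<open>v\<close> and \<open>P\<close> the orthogonal projection, the
  continuous normal map is the discrete one plus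
  \<open>\<tau> (p\<^sub>h - p) + (G p - G p\<^sub>h) + (G p\<^sub>h - P (G p\<^sub>h)) + P (G p\<^sub>h - G\<^sub>h p\<^sub>h)\<close>, where \<open>G\<close> and \<open>G\<^sub>h\<close>
  are the gradients, and each summand is one of the error terms. The hypotheses apply at \<open>p\<close> and
  \<open>p\<^sub>h\<close> because these lie in the effective domains, which amounts to existence of the minimizers.
  A minimizer is obtained as the limit of a minimizing sequence, which is Cauchy by strong
  convexity. Applied to minus a bounded linear functional, the same existence result yields
  the Riesz representation, and hence gradients and orthogonal projections.
\<close>

subsection \<open>Existence of minimizers\<close>

text \<open>
  Near a point \<open>a\<close> of the domain, \<open>f\<close> exceeds \<open>f a - 1\<close> as the sublevel set is closed;
  convexity along the rays from \<open>a\<close> turns this into a global bound.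
\<close>
lemma convex_on_linear_lower_bound:
  fixes f :: "'a::real_inner \<Rightarrow> real"
  assumes cvx: "convex_on D f"
    and cl: "\<And>c. closed {x \<in> D. f x \<le> c}"
    and a: "a \<in> D"
  obtains K where "K \<ge> 0" "\<And>v. v \<in> D \<Longrightarrow> f a - 1 - K * norm (v - a) \<le> f v"
proof -
  have "open (- {x \<in> D. f x \<le> f a - 1})" "a \<in> - {x \<in> D. f x \<le> f a - 1}"
    using cl by auto
  then obtain r where r: "r > 0" "ball a r \<subseteq> - {x \<in> D. f x \<le> f a - 1}"
    using openE by blast
  have "f a - 1 - 2 / r * norm (v - a) \<le> f v" if v: "v \<in> D" for v
  proof (cases "v \<in> ball a r")
    case True
    with r v have "f a - 1 \<le> f v" by force
    moreover have "0 \<le> 2 / r * norm (v - a)" using r by simp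
    ultimately show ?thesis by linarith
  next
    case False
    define n where "n = norm (v - a)"
    \<comment> \<open>This places \<open>x\<close> on the segment from \<open>a\<close> to
      \<open>v\<close> at distance \<open>r / 2\<close> from \<open>a\<close>, inside the ball;
      \<open>n \<ge> r\<close> keeps \<open>t\<close> below 1.\<close>
    define t where "t = r / (2 * n)"
    have n: "n \<ge> r" "n > 0" using False r by (auto simp: n_def dist_norm norm_minus_commute)
    have t: "0 < t" "t \<le> 1" using n r by (auto simp: t_def field_simps)
    define x where "x = (1 - t) *\<^sub>R a + t *\<^sub>R v"
    have "x - a = t *\<^sub>R (v - a)" by (simp add: x_def algebra_simps)
    then have "norm (x - a) = t * n" using t by (simp add: n_def)
    also have "\<dots> < r" using n r by (simp add: t_def)
    finally have "x \<in> ball a r" by (simp add: dist_norm norm_minus_commute)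
    moreover have "x \<in> D"
      using convex_on_imp_convex[OF cvx] a v t unfolding x_def convex_alt by auto
    ultimately have "f a - 1 \<le> f x" using r by force
    also have "f x \<le> (1 - t) * f a + t * f v"
      unfolding x_def using convex_onD[OF cvx, of t a v] a v t by auto
    finally have "t * (f a - f v) \<le> 1" by (simp add: algebra_simps)
    then have "f a - f v \<le> 1 / t" using t by (simp add: field_simps)
    also have "1 / t = 2 / r * n" using n r by (simp add: t_def)
    finally show ?thesis by (simp add: n_def)
  qed
  with r show thesis by (intro that[of "2 / r"]) auto
qed

text \<open>The parallelogram law centred at \<open>u\<close>. The term with \<open>1/8\<close> is
  the strong convexity gain that makes minimizing sequences Cauchy.\<close>

lemma half_norm_sq_midpoint:
  fixes x y u :: "'a::real_inner"
  shows "1/2 * (norm ((1/2) *\<^sub>R x + (1/2) *\<^sub>R y - u))\<^sup>2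
    = 1/2 * (1/2 * (norm (x - u))\<^sup>2) + 1/2 * (1/2 * (norm (y - u))\<^sup>2) - 1/8 * (norm (x - y))\<^sup>2"
  by (simp add: power2_norm_eq_inner inner_diff inner_add inner_commute algebra_simps)
    (simp add: field_simps)

text \<open>Closed sublevel sets in the whole space encode lower semicontinuity of the extension of
  \<open>f\<close> by infinity, so \<open>D\<close> may be an effective domain that is not
  closed.\<close>

lemma prox_objective_minimizer_exists:
  fixes f :: "'a::{real_inner,complete_space} \<Rightarrow> real"
  assumes cvx: "convex_on D f" and cl: "\<And>c. closed {x \<in> D. f x \<le> c}" and "D \<noteq> {}"
  obtains p where "p \<in> D"
    "\<And>v. v \<in> D \<Longrightarrow> 1/2 * (norm (p - u))\<^sup>2 + f p \<le> 1/2 * (norm (v - u))\<^sup>2 + f v"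
proof -
  obtain a where a: "a \<in> D" using \<open>D \<noteq> {}\<close> by auto
  obtain K where K: "K \<ge> 0" "\<And>v. v \<in> D \<Longrightarrow> f a - 1 - K * norm (v - a) \<le> f v"
    using convex_on_linear_lower_bound[OF cvx cl a] by blast
  define g where "g v = 1/2 * (norm (v - u))\<^sup>2 + f v" for v
  \<comment> \<open>The quadratic absorbs the linear decay of \<open>f\<close>: with
    \<open>s = norm (v - u)\<close>, completing the square bounds \<open>s^2 / 2 - K * s\<close>
    below by \<open>- K^2 / 2\<close>.\<close>
  have "f a - 1 - K * norm (u - a) - K\<^sup>2 / 2 \<le> g v" if "v \<in> D" for v
  proof -
    have "norm (v - a) \<le> norm (v - u) + norm (u - a)"
      using norm_triangle_ineq[of "v - u" "u - a"] by simp
    then have "K * norm (v - a) \<le> K * norm (v - u) + K * norm (u - a)"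
      using mult_left_mono[OF _ K(1)] by (metis distrib_left)
    moreover have "0 \<le> (norm (v - u) - K)\<^sup>2" by simp
    ultimately show ?thesis
      using K(2)[OF that] by (simp add: g_def power2_eq_square algebra_simps)
  qed
  then have bdd: "bdd_below (g ` D)" by (rule bdd_belowI2)
  define m where "m = Inf (g ` D)"
  have m: "m \<le> g v" if "v \<in> D" for v
    unfolding m_def using bdd that by (intro cInf_lower) auto
  have "\<exists>v\<in>D. g v < m + 1 / real (Suc n)" for n
  proof -
    have "Inf (g ` D) < m + 1 / real (Suc n)" unfolding m_def by simp
    then show ?thesis using cInf_less_iff[OF _ bdd] a by blast
  qed
  then obtain x where x: "\<And>n. x n \<in> D" "\<And>n. g (x n) < m + 1 / real (Suc n)" by metis
  \<comment> \<open>The midpoint of two nearly optimal points cannot fall below \<open>m\<close>, so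
    the gain at the midpoint is at most \<open>e\<close>.\<close>
  have gap: "(norm (v - w))\<^sup>2 \<le> 8 * e" if "v \<in> D" "w \<in> D" "g v \<le> m + e" "g w \<le> m + e" for v w e
  proof -
    let ?z = "(1/2) *\<^sub>R v + (1/2) *\<^sub>R w"
    have "?z \<in> D"
      using convexD[OF convex_on_imp_convex[OF cvx], of v w "1/2" "1/2"] that by auto
    then have "m \<le> g ?z" by (rule m)
    also have "f ?z \<le> 1/2 * f v + 1/2 * f w"
      using convex_onD[OF cvx, of "1/2" v w] that by auto
    then have "g ?z \<le> 1/2 * g v + 1/2 * g w - 1/8 * (norm (v - w))\<^sup>2"
      unfolding g_def half_norm_sq_midpoint by (simp add: field_simps)
    finally show ?thesis using that by linarith
  qed
  have "Cauchy x"
  proof (rule CauchyI)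
    fix e :: real assume "e > 0"
    then obtain N where N: "1 / real (Suc N) < e\<^sup>2 / 8"
      using nat_approx_posE[of "e\<^sup>2 / 8"] by auto
    have "norm (x i - x j) < e" if "i \<ge> N" "j \<ge> N" for i j
    proof -
      have "g (x k) \<le> m + 1 / real (Suc N)" if "k \<ge> N" for k
      proof -
        have "1 / real (Suc k) \<le> 1 / real (Suc N)" using that by (simp add: frac_le)
        then show ?thesis using x(2)[of k] by linarith
      qed
      then have "(norm (x i - x j))\<^sup>2 \<le> 8 * (1 / real (Suc N))"
        using that x(1) by (intro gap) auto
      then have "(norm (x i - x j))\<^sup>2 < e\<^sup>2" using N by linarith
      then show ?thesis by (rule power_less_imp_less_base) (use \<open>e > 0\<close> in simp)
    qed
    then show "\<exists>N. \<forall>i\<ge>N. \<forall>j\<ge>N. norm (x i - x j) < e" by blast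
  qed
  then obtain p where p: "x \<longlonglongrightarrow> p" using Cauchy_convergent convergent_def by blast
  \<comment> \<open>These terms bound \<open>f (x n)\<close> from above. Any \<open>c\<close> beyond
    their limit eventually bounds \<open>f (x n)\<close>, and closedness of the sublevel set carries
    both \<open>f p \<le> c\<close> and \<open>p \<in> D\<close> to the limit.\<close>
  have lim: "(\<lambda>n. m + 1 / real (Suc n) - 1/2 * (norm (x n - u))\<^sup>2) \<longlonglongrightarrow> m + 0 - 1/2 * (norm (p - u))\<^sup>2"
    by (intro tendsto_intros p LIMSEQ_Suc[OF lim_1_over_n])
  have pc: "p \<in> {x \<in> D. f x \<le> c}" if c: "m - 1/2 * (norm (p - u))\<^sup>2 < c" for c
  proof (rule Lim_in_closed_set[OF cl _ _ p])
    have "\<forall>\<^sub>F n in sequentially. m + 1 / real (Suc n) - 1/2 * (norm (x n - u))\<^sup>2 < c"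
      using order_tendstoD(2)[OF lim] c by simp
    then show "\<forall>\<^sub>F n in sequentially. x n \<in> {x \<in> D. f x \<le> c}"
    proof eventually_elim
      case (elim n)
      then show ?case using x(1)[of n] x(2)[of n] by (simp add: g_def)
    qed
  qed simp
  have "f p \<le> m - 1/2 * (norm (p - u))\<^sup>2"
    by (rule dense_ge) (use pc in blast)
  then have "g p \<le> m" by (simp add: g_def)
  then have "g p \<le> g v" if "v \<in> D" for v using m[OF that] by linarith
  moreover have "p \<in> D" using pc[of "m - 1/2 * (norm (p - u))\<^sup>2 + 1"] by simp
  ultimately show thesis using that[of p] unfolding g_def by blast
qed

subsection \<open>Proximal points\<close>

text \<open>If \<open>\<phi> x\<close> exceeded \<open>c\<close> at a limit point \<open>x\<close>,
  lower semicontinuity would keep \<open>\<phi>\<close> above \<open>c\<close> on a punctured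
  neighbourhood in \<open>H\<close>, which contains sublevel points.\<close>

lemma lsc_in_closed_sublevel:
  assumes "lsc_in H \<phi>" "closed H"
  shows "closed {x \<in> H. \<phi> x \<le> c}"
proof -
  have "x \<in> H \<and> \<phi> x \<le> c" if lim: "x islimpt {x \<in> H. \<phi> x \<le> c}" for x
  proof
    have "x islimpt H" by (rule islimpt_subset[OF lim]) auto
    with \<open>closed H\<close> show "x \<in> H" unfolding closed_limpt by blast
    then have le: "\<phi> x \<le> Liminf (at x within H) \<phi>" using assms by (simp add: lsc_in_def)
    show "\<phi> x \<le> c"
    proof (rule ccontr)
      assume "\<not> \<phi> x \<le> c"
      then have "\<forall>\<^sub>F y in at x within H. c < \<phi> y" 
        using less_LiminfD[of c "at x within H" \<phi>] le by (simp add: not_le)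
      then obtain T where T: "open T" "x \<in> T" "\<And>y. y \<in> T \<Longrightarrow> y \<noteq> x \<Longrightarrow> y \<in> H \<Longrightarrow> c < \<phi> y"
        unfolding eventually_at_topological by blast
      obtain y where "y \<in> H" "\<phi> y \<le> c" "y \<in> T" "y \<noteq> x"
        using islimptE[OF lim T(2,1)] by blast
      with T(3) show False by (meson leD)
    qed
  qed
  then show ?thesis unfolding closed_limpt by blast
qed

lemma proper_in_dom:
  assumes "proper_in H \<phi>" "x \<in> dom_in H \<phi>"
  shows "\<phi> x = ereal (real_of_ereal (\<phi> x))"
  using assms by (cases "\<phi> x") (auto simp: proper_in_def dom_in_def)

text \<open>On the effective domain the extended inequality has a finite right-hand side; this puts
  the convex combination back into the domain and lets the inequality be read over the
  reals.\<close>

lemma convex_in_dom: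
  assumes "convex_in H \<phi>" "proper_in H \<phi>" "convex H"
  shows "convex_on (dom_in H \<phi>) (\<lambda>x. real_of_ereal (\<phi> x))"
proof -
  have *: "(1 - t) *\<^sub>R x + t *\<^sub>R y \<in> dom_in H \<phi> \<and>
      real_of_ereal (\<phi> ((1 - t) *\<^sub>R x + t *\<^sub>R y))
        \<le> (1 - t) * real_of_ereal (\<phi> x) + t * real_of_ereal (\<phi> y)"
    if xy: "x \<in> dom_in H \<phi>" "y \<in> dom_in H \<phi>" and t: "0 \<le> t" "t \<le> 1" for x y t
  proof -
    let ?z = "(1 - t) *\<^sub>R x + t *\<^sub>R y"
    have H: "x \<in> H" "y \<in> H" using xy by (auto simp: dom_in_def)
    then have z: "?z \<in> H" using t assms(3) by (simp add: convex_alt)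
    have "\<phi> ?z \<le> ereal (1 - t) * \<phi> x + ereal t * \<phi> y"
      using assms(1) H t unfolding convex_in_def by auto
    also have "\<dots> = ereal ((1 - t) * real_of_ereal (\<phi> x) + t * real_of_ereal (\<phi> y))"
      using proper_in_dom[OF assms(2) xy(1)] proper_in_dom[OF assms(2) xy(2)]
      by (metis plus_ereal.simps(1) times_ereal.simps(1))
    finally have le: "\<phi> ?z \<le> \<dots>" .
    then have zd: "?z \<in> dom_in H \<phi>" using z by (auto simp: dom_in_def)
    show ?thesis using le zd proper_in_dom[OF assms(2) zd] by (metis ereal_less_eq(3))
  qed
  then have "convex (dom_in H \<phi>)" unfolding convex_alt by blast
  then show ?thesis using * by (intro convex_onI) auto
qed

text \<open>\<open>arg_min\<close> is a choice operator and yields a minimizer only once one exists.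
  Any minimizer does at least as well as a point with finite objective, hence lies in the
  domain.\<close>

lemma prox_in_dom:
  fixes \<phi> :: "'a::{real_inner,complete_space} \<Rightarrow> ereal"
  assumes "proper_in H \<phi>" "lsc_in H \<phi>" "convex_in H \<phi>" "closed H" "convex H" "\<tau> > 0"
  shows "prox H (\<lambda>u. \<phi> u / ereal \<tau>) v \<in> dom_in H \<phi>"
proof -
  let ?D = "dom_in H \<phi>"
  define f where "f x = 1 / \<tau> * real_of_ereal (\<phi> x)" for x
  let ?g = "\<lambda>w. ereal (1/2 * (norm (w - v))\<^sup>2) + \<phi> w / ereal \<tau>"
  have fin: "?g w = ereal (1/2 * (norm (w - v))\<^sup>2 + f w)" if w: "w \<in> ?D" for w
    by (subst proper_in_dom[OF assms(1) w]) (use \<open>\<tau> > 0\<close> in \<open>simp add: f_def\<close>)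
  have inf: "?g w = \<infinity>" if "w \<in> H" "w \<notin> ?D" for w
    using that \<open>\<tau> > 0\<close> by (auto simp: dom_in_def)
  have "{x \<in> ?D. f x \<le> c} = {x \<in> H. \<phi> x \<le> ereal (\<tau> * c)}" for c
  proof -
    have "f x \<le> c \<longleftrightarrow> \<phi> x \<le> ereal (\<tau> * c)" if "x \<in> ?D" for x
      using proper_in_dom[OF assms(1) that] \<open>\<tau> > 0\<close>
      by (cases "\<phi> x") (auto simp: f_def field_simps)
    moreover have "x \<in> ?D" if "x \<in> H" "\<phi> x \<le> ereal (\<tau> * c)" for x
      using that by (auto simp: dom_in_def)
    ultimately show ?thesis by (auto simp: dom_in_def)
  qed
  then have cl: "closed {x \<in> ?D. f x \<le> c}" for c
    using lsc_in_closed_sublevel[OF assms(2,4)] by simp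
  have cvx: "convex_on ?D f"
    unfolding f_def using assms by (intro convex_on_cmul convex_in_dom) auto
  have "?D \<noteq> {}" using assms(1) by (simp add: proper_in_def)
  then obtain p where p: "p \<in> ?D"
    "\<And>w. w \<in> ?D \<Longrightarrow> 1/2 * (norm (p - v))\<^sup>2 + f p \<le> 1/2 * (norm (w - v))\<^sup>2 + f w"
    using prox_objective_minimizer_exists[OF cvx cl] by metis
  have le: "?g p \<le> ?g w" if "w \<in> H" for w
    by (cases "w \<in> ?D") (use p that fin inf in auto)
  have pH: "p \<in> H" using p(1) by (simp add: dom_in_def)
  have "is_arg_min ?g (\<lambda>w. w \<in> H) p"
    using le pH by (auto simp: is_arg_min_def not_less)
  then have "is_arg_min ?g (\<lambda>w. w \<in> H) (prox H (\<lambda>u. \<phi> u / ereal \<tau>) v)"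
    unfolding prox_def arg_min_def by (rule someI)
  moreover define q where "q = prox H (\<lambda>u. \<phi> u / ereal \<tau>) v"
  ultimately have q: "q \<in> H" "\<not> ?g p < ?g q" using pH by (auto simp: is_arg_min_def)
  have "q \<in> ?D"
  proof (rule ccontr)
    assume "q \<notin> ?D"
    with q(1) have "?g q = \<infinity>" by (rule inf)
    with q(2) fin[OF p(1)] show False by simp
  qed
  then show ?thesis by (simp add: q_def)
qed

subsection \<open>Riesz representation and orthogonal projection\<close>

lemma linear_coeff_zero:
  fixes a b :: real
  assumes "\<And>t. 0 \<le> t * a + t\<^sup>2 * b"
  shows "a = 0"
proof (rule ccontr)
  assume "a \<noteq> 0"
  define c where "c = \<bar>b\<bar> + 1"
  have "c > 0" "b < c" by (auto simp: c_def)
  \<comment> \<open>At \<open>t = - a / c\<close> the two terms would cancel exactly if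
    \<open>b\<close> were \<open>c\<close>; as \<open>b < c\<close>, the sum is negative.\<close>
  have "0 \<le> (- a / c) * a + (- a / c)\<^sup>2 * b" by (rule assms)
  also have "\<dots> < (- a / c) * a + (- a / c)\<^sup>2 * c"
    using \<open>a \<noteq> 0\<close> \<open>c > 0\<close> \<open>b < c\<close> by (intro add_strict_left_mono mult_strict_left_mono) auto
  also have "\<dots> = 0" using \<open>c > 0\<close> by (simp add: power2_eq_square field_simps)
  finally show False by simp
qed

text \<open>The representative is the minimizer over \<open>H\<close> of half the squared norm minus
  \<open>f\<close>; the first-order condition at it is the representation formula.\<close>

lemma Riesz_subspace:
  fixes f :: "'a::{real_inner,complete_space} \<Rightarrow> real"
  assumes H: "subspace H" "closed H" and f: "bounded_linear f"
  obtains g where "g \<in> H" "\<And>w. w \<in> H \<Longrightarrow> f w = inner w g"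
proof -
  interpret bounded_linear f by (rule f)
  have "convex H" using H by (simp add: subspace_imp_convex)
  then have cvx: "convex_on H (\<lambda>x. - f x)"
    by (intro convex_onI) (simp_all add: add scaleR)
  have cl: "closed {x \<in> H. - f x \<le> c}" for c
  proof -
    have "continuous_on UNIV (\<lambda>x. - f x)"
      by (intro continuous_intros continuous_on[OF continuous_on_id])
    then have "closed {x. - f x \<le> c}" by (intro closed_Collect_le) auto
    moreover have "{x \<in> H. - f x \<le> c} = H \<inter> {x. - f x \<le> c}" by auto
    ultimately show ?thesis using H by auto
  qed
  have "H \<noteq> {}" using subspace_0[OF H(1)] by auto
  then obtain p where p: "p \<in> H"
    "\<And>v. v \<in> H \<Longrightarrow> 1/2 * (norm (p - 0))\<^sup>2 + - f p \<le> 1/2 * (norm (v - 0))\<^sup>2 + - f v"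
    using prox_objective_minimizer_exists[OF cvx cl] by metis
  have "f w = inner w p" if w: "w \<in> H" for w
  proof -
    \<comment> \<open>The increase of the objective from \<open>p\<close> to
      \<open>p + t *\<^sub>R w\<close>, nonnegative for both signs of \<open>t\<close>.\<close>
    have "0 \<le> t * (inner w p - f w) + t\<^sup>2 * (1/2 * (norm w)\<^sup>2)" for t
    proof -
      have "p + t *\<^sub>R w \<in> H" using H p(1) w by (simp add: subspace_add subspace_scale)
      from p(2)[OF this] show ?thesis
        unfolding power2_norm_eq_inner
        by (simp add: add scaleR inner_add inner_commute power2_eq_square algebra_simps)
    qed
    then show ?thesis using linear_coeff_zero by fastforce
  qed
  with p(1) that show thesis by blast
qed

text \<open>Supplies the uniqueness behind the definite descriptions \<open>orth_proj\<close> and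
  \<open>gradient\<close>.\<close>

lemma subspace_inner_eq:
  assumes "subspace H" "g \<in> H" "g' \<in> H" "\<And>w. w \<in> H \<Longrightarrow> inner w g = inner w g'"
  shows "g = g'"
proof -
  have "inner (g - g') (g - g') = 0"
    using assms(4)[of "g - g'"] subspace_diff[OF assms(1-3)] by (simp add: inner_diff)
  then show ?thesis by simp
qed

lemma orth_proj_unique:
  assumes "subspace H" "p \<in> H" "\<And>w. w \<in> H \<Longrightarrow> inner w p = inner w u"
  shows "orth_proj H u = p"
  unfolding orth_proj_def
proof (rule the_equality)
  show "p \<in> H \<and> (\<forall>w\<in>H. orthogonal (u - p) w)"
    using assms by (simp add: orthogonal_def inner_diff inner_commute)
  show "q = p" if "q \<in> H \<and> (\<forall>w\<in>H. orthogonal (u - q) w)" for q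
    using that assms
    by (intro subspace_inner_eq[OF assms(1)]) (auto simp: orthogonal_def inner_diff inner_commute)
qed

text \<open>The projection of \<open>u\<close> is the Riesz representative in \<open>H\<close> of
  the inner product with \<open>u\<close>.\<close>

lemma orth_proj:
  fixes u :: "'a::{real_inner,complete_space}"
  assumes H: "subspace H" "closed H"
  shows "orth_proj H u \<in> H" "\<And>w. w \<in> H \<Longrightarrow> inner w (orth_proj H u) = inner w u"
proof -
  obtain p where p: "p \<in> H" "\<And>w. w \<in> H \<Longrightarrow> inner w u = inner w p"
    using Riesz_subspace[OF H bounded_linear_inner_left[of u]] by metis
  then have "orth_proj H u = p" using H by (intro orth_proj_unique) auto
  with p show "orth_proj H u \<in> H" "\<And>w. w \<in> H \<Longrightarrow> inner w (orth_proj H u) = inner w u" by auto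
qed

lemma orth_proj_diff:
  fixes u v :: "'a::{real_inner,complete_space}"
  assumes H: "subspace H" "closed H"
  shows "orth_proj H (u - v) = orth_proj H u - orth_proj H v"
  using orth_proj[OF H] H(1)
  by (intro orth_proj_unique) (auto simp: subspace_diff inner_diff)

lemma norm_orth_proj_le:
  fixes u :: "'a::{real_inner,complete_space}"
  assumes H: "subspace H" "closed H"
  shows "norm (orth_proj H u) \<le> norm u"
proof -
  let ?p = "orth_proj H u"
  have "norm ?p * norm ?p = inner ?p u"
    using orth_proj(2)[OF H orth_proj(1)[OF H], of u u]
    by (simp add: power2_norm_eq_inner flip: power2_eq_square)
  also have "\<dots> \<le> norm ?p * norm u" by (rule norm_cauchy_schwarz)
  finally show ?thesis
    by (cases "norm ?p = 0") (auto simp: mult_le_cancel_left_pos)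
qed

subsection \<open>Gradients\<close>

text \<open>\<open>H\<close> may have empty interior, so derivatives within \<open>H\<close> are
  determined only along \<open>H\<close>. Restricting to the line through \<open>u\<close> in
  direction \<open>d\<close> reduces the claim to uniqueness for functions of a real
  variable.\<close>

lemma has_derivative_within_subspace_unique:
  fixes f :: "'a::real_normed_vector \<Rightarrow> real"
  assumes H: "subspace H" "u \<in> H" "d \<in> H"
    and D: "(f has_derivative D) (at u within H)" "(f has_derivative E) (at u within H)"
  shows "D d = E d"
proof -
  have *: "((\<lambda>t::real. f (u + t *\<^sub>R d)) has_derivative (\<lambda>t. F (t *\<^sub>R d))) (at 0)"
    if "(f has_derivative F) (at u within H)" for F
  proof -
    have "((\<lambda>t::real. u + t *\<^sub>R d) has_derivative (\<lambda>t. t *\<^sub>R d)) (at 0)"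
      by (auto intro!: derivative_eq_intros)
    moreover have "range (\<lambda>t::real. u + t *\<^sub>R d) \<subseteq> H"
      using H by (auto simp: subspace_add subspace_scale)
    then have "(f has_derivative F) (at (u + 0 *\<^sub>R d) within range (\<lambda>t::real. u + t *\<^sub>R d))"
      using that has_derivative_subset by auto
    ultimately show ?thesis by (rule has_derivative_in_compose)
  qed
  show ?thesis
    using has_derivative_unique[OF *[OF D(1)] *[OF D(2)]] by (metis scaleR_one)
qed

lemma gradient_unique:
  assumes H: "subspace H" "u \<in> H"
    and g: "g \<in> H" "(f has_derivative (\<lambda>d. inner d g)) (at u within H)"
  shows "gradient H f u = g"
  unfolding gradient_def
proof (rule the_equality)
  show "g' = g" if "g' \<in> H \<and> (f has_derivative (\<lambda>d. inner d g')) (at u within H)" for g'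
    using that g has_derivative_within_subspace_unique[OF H]
    by (intro subspace_inner_eq[OF H(1)]) blast+
qed (use g in auto)

text \<open>Difference quotients within \<open>H\<close> evaluate the derivative only at increments
  \<open>y - u\<close> in \<open>H\<close>, so its values elsewhere can be exchanged.\<close>

lemma has_derivative_within_subspace_cong:
  assumes H: "subspace H" "u \<in> H"
    and f: "(f has_derivative D) (at u within H)"
    and E: "bounded_linear E" "\<And>d. d \<in> H \<Longrightarrow> D d = E d"
  shows "(f has_derivative E) (at u within H)"
proof -
  have "\<forall>\<^sub>F y in at u within H. y \<in> H" by (simp add: eventually_at_filter)
  then have ev: "\<forall>\<^sub>F y in at u within H. D (y - u) = E (y - u)"
    by eventually_elim (use H E in \<open>simp add: subspace_diff\<close>)
  have "((\<lambda>y. (1 / norm (y - u)) *\<^sub>R (f y - (f u + D (y - u)))) \<longlongrightarrow> 0) (at u within H)"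
    using f by (simp add: has_derivative_within)
  then have "((\<lambda>y. (1 / norm (y - u)) *\<^sub>R (f y - (f u + E (y - u)))) \<longlongrightarrow> 0) (at u within H)"
    by (rule Lim_transform_eventually) (use ev in eventually_elim, simp)
  then show ?thesis using E by (simp add: has_derivative_within)
qed

text \<open>A vector and its projection have the same inner products with \<open>H\<close>, so the
  projected ambient gradient represents the derivative within \<open>H\<close>.\<close>

lemma gradient_eq_orth_proj:
  fixes u :: "'a::{real_inner,complete_space}"
  assumes H: "subspace H" "closed H" "u \<in> H" and f: "f differentiable (at u)"
  shows "gradient H f u = orth_proj H (gradient UNIV f u)"
proof -
  obtain D where D: "(f has_derivative D) (at u)" using f unfolding differentiable_def by blast
  obtain g where g: "\<And>w. D w = inner w g"
    using Riesz_subspace[OF subspace_UNIV closed_UNIV has_derivative_bounded_linear[OF D]]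
    by auto
  have G: "gradient UNIV f u = g"
    using D unfolding ext[of D "\<lambda>d. inner d g", OF g]
    by (rule gradient_unique[OF subspace_UNIV UNIV_I UNIV_I])
  have "(f has_derivative (\<lambda>d. inner d (orth_proj H g))) (at u within H)"
    by (rule has_derivative_within_subspace_cong[OF H(1,3) has_derivative_at_withinI[OF D]])
      (simp_all add: g orth_proj(2)[OF H(1,2)] bounded_linear_inner_left)
  then show ?thesis
    unfolding G using gradient_unique[OF H(1,3) orth_proj(1)[OF H(1,2)]] by blast
qed

lemma reduced_obj_differentiable:
  assumes "cont_diff UNIV UNIV J" "cont_diff V Z S" "u \<in> V"
  shows "reduced_obj J S differentiable (at u)"
proof -
  obtain S' where S': "(S has_derivative S') (at u)" using assms unfolding cont_diff_def by blast
  obtain J' where J': "(J has_derivative J') (at (S u, u))"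
    using assms unfolding cont_diff_def by blast
  have "((\<lambda>u. (S u, u)) has_derivative (\<lambda>d. (S' d, d))) (at u)"
    by (intro has_derivative_Pair S' has_derivative_ident)
  from has_derivative_compose[OF this J'] show ?thesis
    unfolding reduced_obj_def[abs_def] differentiable_def by blast
qed

section \<open>Comparison of the continuous and discrete normal maps\<close>

theorem theorem1:
  fixes \<psi> :: "'u::{real_inner,complete_space,second_countable_topology} \<Rightarrow> ereal"
    and V\<^sub>U W\<^sub>U :: "'u set"
    and J :: "'y::{banach,second_countable_topology} \<times> 'u \<Rightarrow> real"
    and S :: "'u \<Rightarrow> 'y"
    and U\<^sub>h :: "real \<Rightarrow> 'u set"
    and Y\<^sub>h :: "real \<Rightarrow> 'y set"
    and \<psi>\<^sub>h :: "real \<Rightarrow> 'u \<Rightarrow> ereal"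
    and S\<^sub>h :: "real \<Rightarrow> 'u \<Rightarrow> 'y"
    and \<iota> :: "'w::banach \<Rightarrow> 'u"
    and \<tau> L l :: real
    and \<rho>Pi \<rho>grad \<rho>prox :: "real \<Rightarrow> real"
  assumes psi: "proper_in UNIV \<psi>" "lsc_in UNIV \<psi>" "convex_in UNIV \<psi>"
    and V: "open V\<^sub>U" "dom_in UNIV \<psi> \<subseteq> V\<^sub>U"
    and J: "cont_diff UNIV UNIV J"
    and S: "cont_diff V\<^sub>U UNIV S"
    and Uh: "\<And>h. h > 0 \<Longrightarrow> subspace (U\<^sub>h h)" "\<And>h. h > 0 \<Longrightarrow> closed (U\<^sub>h h)"
    and Yh: "\<And>h. h > 0 \<Longrightarrow> subspace (Y\<^sub>h h)"
    and psih: "\<And>h. h > 0 \<Longrightarrow> proper_in (U\<^sub>h h) (\<psi>\<^sub>h h)"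
      "\<And>h. h > 0 \<Longrightarrow> lsc_in (U\<^sub>h h) (\<psi>\<^sub>h h)"
      "\<And>h. h > 0 \<Longrightarrow> convex_in (U\<^sub>h h) (\<psi>\<^sub>h h)"
      "\<And>h. h > 0 \<Longrightarrow> dom_in (U\<^sub>h h) (\<psi>\<^sub>h h) \<subseteq> V\<^sub>U"
    and Sh: "\<And>h. h > 0 \<Longrightarrow> cont_diff V\<^sub>U (Y\<^sub>h h) (S\<^sub>h h)"
    and tau: "\<tau> > 0"
    \<comment> \<open>\<open>\<iota>\<close> is the inclusion of the reflexive space \<open>'w\<close>, which carries its own norm\<close>
    and What: "reflexive_space TYPE('w)"
    and iota: "bounded_linear \<iota>" "inj \<iota>" "closure (range \<iota>) = UNIV"
    and rho_Pi: "error_fun \<rho>Pi"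
      "\<And>h w. h > 0 \<Longrightarrow> norm (orth_proj (U\<^sub>h h) (\<iota> w) - \<iota> w) \<le> \<rho>Pi h * norm w"
    and W: "W\<^sub>U \<subseteq> V\<^sub>U" "bounded W\<^sub>U" "dom_in UNIV \<psi> \<subseteq> W\<^sub>U"
      "\<And>h. h > 0 \<Longrightarrow> dom_in (U\<^sub>h h) (\<psi>\<^sub>h h) \<subseteq> W\<^sub>U"
    and Lip: "L > 0" "lipschitz_on L W\<^sub>U (gradient UNIV (reduced_obj J S))"
    and reg: "l > 0"
      "\<And>h v. h > 0 \<Longrightarrow> v \<in> W\<^sub>U \<inter> U\<^sub>h h \<Longrightarrow>
         gradient UNIV (reduced_obj J S) v \<in> range \<iota> \<and> norm (inv \<iota> (gradient UNIV (reduced_obj J S) v)) \<le> l"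
    and rho_grad: "error_fun \<rho>grad"
      "\<And>h v. h > 0 \<Longrightarrow> v \<in> W\<^sub>U \<inter> U\<^sub>h h \<Longrightarrow>
         norm (gradient UNIV (reduced_obj J (S\<^sub>h h)) v - gradient UNIV (reduced_obj J S) v) \<le> \<rho>grad h"
    and rho_prox: "error_fun \<rho>prox"
      "\<And>h v. h > 0 \<Longrightarrow> v \<in> U\<^sub>h h \<Longrightarrow>
         norm (prox UNIV (\<lambda>u. \<psi> u / ereal \<tau>) v - prox (U\<^sub>h h) (\<lambda>u. \<psi>\<^sub>h h u / ereal \<tau>) v) \<le> \<rho>prox h"
  shows "\<forall>h>0. \<forall>v \<in> W\<^sub>U \<inter> U\<^sub>h h.
    chi_nor UNIV \<psi> (reduced_obj J S) \<tau> v
      \<le> chi_nor (U\<^sub>h h) (\<psi>\<^sub>h h) (reduced_obj J (S\<^sub>h h)) \<tau> v + (\<tau> + L) * \<rho>prox h + \<rho>grad h + \<rho>Pi h * l"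
proof (intro allI impI ballI)
  fix h :: real and v assume h: "h > 0" and v: "v \<in> W\<^sub>U \<inter> U\<^sub>h h"
  let ?H = "U\<^sub>h h"
  let ?P = "orth_proj ?H"
  let ?G = "gradient UNIV (reduced_obj J S)"
  let ?Gh = "gradient UNIV (reduced_obj J (S\<^sub>h h))"
  define p where "p = prox UNIV (\<lambda>u. \<psi> u / ereal \<tau>) v"
  define q where "q = prox ?H (\<lambda>u. \<psi>\<^sub>h h u / ereal \<tau>) v"
  note H = Uh(1)[OF h] Uh(2)[OF h]
  have "p \<in> dom_in UNIV \<psi>" unfolding p_def using psi tau by (intro prox_in_dom) auto
  then have pW: "p \<in> W\<^sub>U" using W by blast
  have "q \<in> dom_in ?H (\<psi>\<^sub>h h)"
    unfolding q_def using psih h H tau by (intro prox_in_dom subspace_imp_convex) auto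
  then have qW: "q \<in> W\<^sub>U" and qH: "q \<in> ?H" using W(4)[OF h] by (auto simp: dom_in_def)
  have "reduced_obj J (S\<^sub>h h) differentiable (at q)"
    using reduced_obj_differentiable[OF J Sh[OF h]] qW W by blast
  then have grad: "gradient ?H (reduced_obj J (S\<^sub>h h)) q = ?P (?Gh q)"
    by (rule gradient_eq_orth_proj[OF H qH])
  have pq: "norm (p - q) \<le> \<rho>prox h" using rho_prox(2)[OF h] v by (simp add: p_def q_def)
  have "norm (\<tau> *\<^sub>R (q - p)) = \<tau> * norm (p - q)" using tau by (simp add: norm_minus_commute)
  also have "\<dots> \<le> \<tau> * \<rho>prox h" using pq tau by simp
  finally have e1: "norm (\<tau> *\<^sub>R (q - p)) \<le> \<tau> * \<rho>prox h" .
  \<comment> \<open>The regularity and gradient error bounds are assumed only on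
    \<open>W\<^sub>U \<inter> U\<^sub>h h\<close>, which contains \<open>q\<close> but possibly not
    \<open>p\<close>; the Lipschitz bound moves the argument from \<open>p\<close> to
    \<open>q\<close>.\<close>
  have "norm (?G p - ?G q) \<le> L * norm (p - q)"
    using lipschitz_onD[OF Lip(2) pW qW] by (simp add: dist_norm)
  also have "\<dots> \<le> L * \<rho>prox h" using pq Lip(1) by simp
  finally have e2: "norm (?G p - ?G q) \<le> L * \<rho>prox h" .
  have e3: "norm (?G q - ?P (?G q)) \<le> \<rho>Pi h * l"
  proof -
    \<comment> \<open>The gradient regarded as an element of the smoother space, whose norm enters
      the projection estimate.\<close>
    define w where "w = inv \<iota> (?G q)"
    have w: "?G q = \<iota> w" "norm w \<le> l"
      using reg(2)[OF h, of q] qW qH by (auto simp: w_def f_inv_into_f)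
    have "norm (?P (\<iota> w) - \<iota> w) \<le> \<rho>Pi h * norm w" by (rule rho_Pi(2)[OF h])
    also have "\<dots> \<le> \<rho>Pi h * l"
      using w(2) rho_Pi(1) h by (intro mult_left_mono) (auto simp: error_fun_def)
    finally show ?thesis by (simp add: w(1) norm_minus_commute)
  qed
  have "norm (?P (?G q - ?Gh q)) \<le> norm (?G q - ?Gh q)" by (rule norm_orth_proj_le[OF H])
  also have "\<dots> \<le> \<rho>grad h" using rho_grad(2)[OF h, of q] qW qH by (simp add: norm_minus_commute)
  finally have e4: "norm (?P (?G q - ?Gh q)) \<le> \<rho>grad h" .
  let ?m = "\<tau> *\<^sub>R (v - q) + ?P (?Gh q)"
  \<comment> \<open>By additivity of the projection the last summand is
    \<open>?P (?G q) - ?P (?Gh q)\<close>, so the sum telescopes.\<close>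
  have decomp: "\<tau> *\<^sub>R (v - p) + ?G p
      = ?m + \<tau> *\<^sub>R (q - p) + (?G p - ?G q) + (?G q - ?P (?G q)) + ?P (?G q - ?Gh q)"
    by (simp add: orth_proj_diff[OF H] algebra_simps)
  have "norm (\<tau> *\<^sub>R (v - p) + ?G p) \<le> norm ?m + norm (\<tau> *\<^sub>R (q - p)) + norm (?G p - ?G q)
      + norm (?G q - ?P (?G q)) + norm (?P (?G q - ?Gh q))"
    unfolding decomp by (intro order_refl norm_triangle_mono)
  then have "norm (\<tau> *\<^sub>R (v - p) + ?G p)
      \<le> norm ?m + (\<tau> + L) * \<rho>prox h + \<rho>grad h + \<rho>Pi h * l"
    using e1 e2 e3 e4 by (simp add: distrib_right)
  then show "chi_nor UNIV \<psi> (reduced_obj J S) \<tau> v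
      \<le> chi_nor ?H (\<psi>\<^sub>h h) (reduced_obj J (S\<^sub>h h)) \<tau> v + (\<tau> + L) * \<rho>prox h + \<rho>grad h + \<rho>Pi h * l"
    by (simp add: chi_nor_def Let_def grad flip: p_def q_def)
qed

end
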